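(* Let $X$ be a non-negative absolutely continuous random variable with cumulative distribution function $F$. Then the weighted cumulative entropy of $X$ can be expressed as $$\mathcal{CE}^w(X)=-\frac12\sum_{n=1}^{+\infty}\frac{1}{n(n+1)}\,\mu^{(2)}_{1:n+1}+\frac12\,\mathbb{E}(X^2),$$ where $\mu^{(2)}_{1:n+1}$ is the second moment of the smallest order statistic in a sample of size $n+1$ from $F$, provided that $\lim_{x\to+\infty} -\frac{x^2}{2}F(x)\log F(x)=0$.
   Context: $\log$ is the natural logarithm. The weighted cumulative entropy of a non-negative absolutely continuous random variable $X$ with cumulative distribution function $F$ is $\mathcal{CE}^w(X)=-\int_0^{+\infty}xF(x)\log F(x)\,dx$. For i.i.d. random variables $X_1,\dots,X_m$ with the distribution of $X$, $X_{k:m}$ denotes the $k$-th smallest value (the $k$-th order statistic), and $\mu^{(2)}_{k:m}=\mathbb{E}(X_{k:m}^2)$; in particular $\mu^{(2)}_{1:m}=\mathbb{E}\big(\min(X_1,\dots,X_m)^2\big)$. *)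

theory Defs
  imports "HOL-Probability.Probability"
begin

text \<open>
  For \<open>F = cdf (distr M borel X)\<close> the integrand \<open>- x F(x) log F(x)\<close> is non-negative on the
  half-line, as \<open>0 \<le> F \<le> 1\<close>, so the integral always exists in \<open>[0, \<infinity>]\<close>. The library's
  \<open>ln 0 = 0\<close> gives the usual convention \<open>0 log 0 = 0\<close>.
\<close>

definition weighted_cumulative_entropy :: "'a measure \<Rightarrow> ('a \<Rightarrow> real) \<Rightarrow> ennreal" where
  "weighted_cumulative_entropy M X =
     (\<integral>\<^sup>+x\<in>{0..}. ennreal (- (x * cdf (distr M borel X) x * ln (cdf (distr M borel X) x))) \<partial>lborel)"

text \<open>
  The sample values are \<open>y 0, \<dots>, y (m - 1)\<close>, but the rank \<open>k\<close> is 1-based: \<open>1 \<le> k \<le> m\<close>.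
\<close>

definition order_statistic :: "nat \<Rightarrow> nat \<Rightarrow> (nat \<Rightarrow> real) \<Rightarrow> real" where
  "order_statistic k m y = sort (map y [0..<m]) ! (k - 1)"

text \<open>
  The i.i.d. sample of size \<open>m\<close> is realised by the coordinate functions on the \<open>m\<close>-fold
  product of the law of \<open>X\<close>. The moment may be infinite.
\<close>

definition order_statistic_moment2 :: "'a measure \<Rightarrow> ('a \<Rightarrow> real) \<Rightarrow> nat \<Rightarrow> nat \<Rightarrow> ennreal" where
  "order_statistic_moment2 M X k m =
     (\<integral>\<^sup>+y. ennreal ((order_statistic k m y)\<^sup>2) \<partial>(\<Pi>\<^sub>M i\<in>{..<m}. distr M borel X))"

end

theory Submission
  imports Defs "HOL-Real_Asymp.Real_Asymp"
begin

text \<open>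
  On the half-line, where \<open>F\<close> is the distribution function of \<open>X\<close> and \<open>g = 1 - F\<close> its tail, the
  Taylor series of the logarithm gives
  \<open>- F ln F = g - (\<Sum>n\<ge>1. g ^ (n + 1) / (n (n + 1)))\<close>. Each power of \<open>g\<close> is itself a tail:
  the minimum of \<open>m\<close> independent copies of \<open>X\<close> exceeds \<open>x\<close> with probability \<open>g x ^ m\<close>. The second
  moment of a non-negative variable is the integral of \<open>2 x\<close> against its tail
  (\<open>nn_integral_square_eq_tail_integral\<close>), so integrating the series term by term against \<open>2 x\<close>,
  which needs only monotone convergence, yields
  \<open>E(X\<^sup>2) = 2 CE + S\<close> in \<open>[0, \<infinity>]\<close>, where \<open>S\<close> is the series of second moments of minima.

  Solving for \<open>CE\<close> requires that \<open>S\<close> be finite. The series is bounded by \<open>g\<^sup>2\<close>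
  (\<open>entropy_kernel_le_square\<close>), and the limit hypothesis forces \<open>g x \<le> 4 / x\<^sup>2\<close> for large \<open>x\<close>
  (\<open>tail_quadratic_decay\<close>), so \<open>2 x (g x)\<^sup>2\<close> is integrable. This decay does not make
  \<open>E(X\<^sup>2)\<close> finite; if it is infinite then so is \<open>CE\<close>, and the identity still holds.
\<close>

section \<open>Second moments as tail integrals\<close>

text \<open>
  Write \<open>z\<^sup>2\<close> as the integral of \<open>2 x\<close> over \<open>0 \<le> x < z\<close> and exchange the integrals.
\<close>

lemma nn_integral_square_eq_tail_integral:
  fixes Z :: "'b \<Rightarrow> real"
  assumes "sigma_finite_measure N" and Z [measurable]: "Z \<in> borel_measurable N"
    and nonneg: "AE w in N. 0 \<le> Z w"
  shows "(\<integral>\<^sup>+w. ennreal ((Z w)\<^sup>2) \<partial>N) =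
    (\<integral>\<^sup>+x\<in>{0..}. ennreal (2 * x) * emeasure N {w \<in> space N. x < Z w} \<partial>lborel)"
proof -
  interpret N: sigma_finite_measure N by fact
  interpret P: pair_sigma_finite N "lborel :: real measure"
    by (intro pair_sigma_finite.intro assms(1) sigma_finite_lborel)
  \<comment> \<open>The strict bound \<open>x < z\<close> makes the tail complementary to the distribution function at
    every point.\<close>
  have square: "ennreal (z\<^sup>2) = (\<integral>\<^sup>+x. (if 0 \<le> x \<and> x < z then ennreal (2 * x) else 0) \<partial>lborel)"
    if "0 \<le> z" for z :: real
  proof -
    have "(\<integral>\<^sup>+x. ennreal (2 * x) * indicator {0..z} x \<partial>lborel) = ennreal (z\<^sup>2 - 0\<^sup>2)"
      by (rule nn_integral_FTC_Icc[where F = "\<lambda>x. x\<^sup>2"]) (auto intro!: derivative_eq_intros that)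
    moreover have "(\<integral>\<^sup>+x. ennreal (2 * x) * indicator {0..z} x \<partial>lborel) =
        (\<integral>\<^sup>+x. (if 0 \<le> x \<and> x < z then ennreal (2 * x) else 0) \<partial>lborel)"
      using AE_lborel_singleton[of z]
      by (intro nn_integral_cong_AE) (auto elim!: eventually_mono simp: indicator_def)
    ultimately show ?thesis by simp
  qed
  have "(\<integral>\<^sup>+w. ennreal ((Z w)\<^sup>2) \<partial>N) =
      (\<integral>\<^sup>+w. \<integral>\<^sup>+x. (if 0 \<le> x \<and> x < Z w then ennreal (2 * x) else 0) \<partial>lborel \<partial>N)"
    using nonneg by (intro nn_integral_cong_AE) (auto elim!: eventually_mono simp: square)
  also have "\<dots> = (\<integral>\<^sup>+x. \<integral>\<^sup>+w. (if 0 \<le> x \<and> x < Z w then ennreal (2 * x) else 0) \<partial>N \<partial>lborel)"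
    by (rule P.Fubini'[symmetric]) measurable
  also have "\<dots> = (\<integral>\<^sup>+x\<in>{0..}. ennreal (2 * x) * emeasure N {w \<in> space N. x < Z w} \<partial>lborel)"
  proof (rule nn_integral_cong)
    fix x :: real
    have "(\<integral>\<^sup>+w. (if 0 \<le> x \<and> x < Z w then ennreal (2 * x) else 0) \<partial>N) =
        (\<integral>\<^sup>+w. (ennreal (2 * x) * indicator {0..} x) * indicator {w \<in> space N. x < Z w} w \<partial>N)"
      by (intro nn_integral_cong) (auto simp: indicator_def)
    also have "\<dots> = (ennreal (2 * x) * indicator {0..} x) * emeasure N {w \<in> space N. x < Z w}"
      by (rule nn_integral_cmult_indicator) measurable
    finally show "(\<integral>\<^sup>+w. (if 0 \<le> x \<and> x < Z w then ennreal (2 * x) else 0) \<partial>N) =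
        ennreal (2 * x) * emeasure N {w \<in> space N. x < Z w} * indicator {0..} x"
      by (simp add: mult_ac)
  qed
  finally show ?thesis .
qed

lemma order_statistic_1_eq_Min:
  assumes "0 < m"
  shows "order_statistic 1 m y = Min (y ` {..<m})"
proof -
  let ?s = "sort (map y [0..<m])"
  have set: "set ?s = y ` {..<m}"
    by (simp add: atLeast0LessThan)
  have "?s ! 0 = Min (set ?s)"
  proof (rule Min_eqI[symmetric])
    show "?s ! 0 \<in> set ?s" using assms by (intro nth_mem) simp
    show "?s ! 0 \<le> z" if z: "z \<in> set ?s" for z
    proof -
      obtain i where "i < length ?s" "z = ?s ! i"
        using z unfolding in_set_conv_nth by blast
      then show ?thesis
        using sorted_nth_mono[OF sorted_sort[of "map y [0..<m]"], of 0 i] by simp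
    qed
  qed simp
  then show ?thesis unfolding set by (simp add: order_statistic_def)
qed

text \<open>
  The minimum exceeds \<open>x\<close> exactly on a box, whose measure is a power of the tail of one factor.
\<close>

lemma order_statistic_moment2_1:
  assumes "prob_space M" and [measurable]: "X \<in> borel_measurable M"
    and nonneg: "AE \<omega> in M. 0 \<le> X \<omega>" and m: "0 < m"
  shows "order_statistic_moment2 M X 1 m =
    (\<integral>\<^sup>+x\<in>{0..}. ennreal (2 * x) * ennreal (measure (distr M borel X) {x<..} ^ m) \<partial>lborel)"
proof -
  let ?D = "distr M borel X" and ?P = "\<Pi>\<^sub>M i\<in>{..<m}. distr M borel X"
  interpret D: prob_space ?D by (intro prob_space.prob_space_distr assms)
  interpret P: product_prob_space "\<lambda>_::nat. ?D" "{..<m}" ..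
  have meas: "(\<lambda>y. Min (y ` {..<m})) \<in> borel_measurable ?P"
    by (intro borel_measurable_Min) auto
  have Min_iff: "x < Min (y ` {..<m}) \<longleftrightarrow> (\<forall>i<m. x < y i)"
    "x \<le> Min (y ` {..<m}) \<longleftrightarrow> (\<forall>i<m. x \<le> y i)" for x :: real and y
    using m by (subst Min_gr_iff Min_ge_iff; auto)+
  have tail: "emeasure ?P {y \<in> space ?P. x < Min (y ` {..<m})} = ennreal (measure ?D {x<..} ^ m)" for x
  proof -
    have "{y \<in> space ?P. x < Min (y ` {..<m})} = (\<Pi>\<^sub>E i\<in>{..<m}. {x<..})"
      by (auto simp: Min_iff space_PiM PiE_def Pi_def)
    moreover have "emeasure ?P (\<Pi>\<^sub>E i\<in>{..<m}. {x<..}) = (\<Prod>i<m. emeasure ?D {x<..})"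
      by (rule P.emeasure_PiM) auto
    ultimately show ?thesis
      by (simp add: D.emeasure_eq_measure ennreal_power)
  qed
  have "AE z in ?D. 0 \<le> z"
    using nonneg by (subst AE_distr_iff) auto
  then have "AE y in ?P. \<forall>i\<in>{..<m}. 0 \<le> y i"
    by (intro AE_finite_allI P.AE_component) auto
  then have "AE y in ?P. 0 \<le> Min (y ` {..<m})"
    by (simp add: Min_iff Ball_def)
  then have "(\<integral>\<^sup>+y. ennreal ((Min (y ` {..<m}))\<^sup>2) \<partial>?P) =
      (\<integral>\<^sup>+x\<in>{0..}. ennreal (2 * x) * emeasure ?P {y \<in> space ?P. x < Min (y ` {..<m})} \<partial>lborel)"
    by (intro nn_integral_square_eq_tail_integral P.sigma_finite_measure_axioms meas)
  then show ?thesis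
    unfolding order_statistic_moment2_def order_statistic_1_eq_Min[OF m] tail .
qed

section \<open>The series of the entropy integrand\<close>

text \<open>
  Since \<open>1 / (n (n + 1)) = 1 / n - 1 / (n + 1)\<close>, the series is a difference of two shifts of
  \<open>- ln (1 - g) = (\<Sum>n\<ge>1. g ^ n / n)\<close>. At \<open>g = 1\<close>, where the logarithm series diverges, it
  telescopes to \<open>1\<close>, in agreement with the convention \<open>0 ln 0 = 0\<close>.
\<close>

lemma entropy_kernel_sums:
  fixes g :: real
  assumes "0 \<le> g" "g \<le> 1"
  shows "(\<lambda>n. 1 / (real (Suc n) * real (Suc n + 1)) * g ^ (Suc n + 1)) sums (g + (1 - g) * ln (1 - g))"
proof (cases "g = 1")
  case True
  have "(\<lambda>n. 1 / real (Suc n) - 1 / real (Suc (Suc n))) sums (1 / real (Suc 0) - 0)"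
    by (rule telescope_sums') (rule LIMSEQ_Suc[OF lim_1_over_n])
  moreover have "1 / real (Suc n) - 1 / real (Suc (Suc n)) = 1 / (real (Suc n) * real (Suc n + 1))" for n
    by (simp add: field_simps)
  ultimately show ?thesis using True by simp
next
  case False
  let ?L = "- ln (1 - g)"
  have "(\<lambda>n. - ((- (- g)) ^ n) / real n) sums ln (1 + (- g))"
    using assms False by (intro ln_series') auto
  then have "(\<lambda>n. g ^ n / real n) sums ?L"
    using sums_minus by fastforce
  then have s1: "(\<lambda>n. g ^ Suc n / real (Suc n)) sums ?L"
    by (subst sums_Suc_iff) simp
  then have "(\<lambda>n. g ^ Suc (Suc n) / real (Suc (Suc n))) sums (?L - g)"
    by (subst sums_Suc_iff) simp
  with sums_mult[OF s1, of g]
  have "(\<lambda>n. g * (g ^ Suc n / real (Suc n)) - g ^ Suc (Suc n) / real (Suc (Suc n))) sums (g * ?L - (?L - g))"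
    by (rule sums_diff)
  moreover have "g * (g ^ Suc n / real (Suc n)) - g ^ Suc (Suc n) / real (Suc (Suc n)) =
      1 / (real (Suc n) * real (Suc n + 1)) * g ^ (Suc n + 1)" for n
    by (simp add: divide_simps) (simp add: algebra_simps)
  ultimately show ?thesis by (simp add: algebra_simps)
qed

lemma entropy_kernel_le_square:
  fixes g :: real
  assumes "0 \<le> g" "g \<le> 1"
  shows "g + (1 - g) * ln (1 - g) \<le> g\<^sup>2"
proof (cases "g = 1")
  case False
  with assms have "ln (1 - g) \<le> - g" using ln_le_minus_one[of "1 - g"] by simp
  with assms have "(1 - g) * ln (1 - g) \<le> (1 - g) * (- g)" by (intro mult_left_mono) auto
  then show ?thesis by (simp add: algebra_simps power2_eq_square)
qed simp

section \<open>Finiteness of the series of moments\<close>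

text \<open>
  Because \<open>1 - F \<le> - ln F\<close> and \<open>F > 1/2\<close> far out, the vanishing expression dominates
  \<open>x\<^sup>2 (1 - F) / 4\<close>; the constant \<open>4\<close> comes from bounding it by \<open>1\<close>.
\<close>

lemma tail_quadratic_decay:
  fixes D :: "real measure"
  assumes "real_distribution D"
    and lim: "((\<lambda>x. - (x\<^sup>2 / 2) * cdf D x * ln (cdf D x)) \<longlongrightarrow> 0) at_top"
  obtains K where "0 < K" "\<And>x. K \<le> x \<Longrightarrow> 1 - cdf D x \<le> 4 / x\<^sup>2"
proof -
  interpret D: real_distribution D by fact
  have "eventually (\<lambda>x. 1 / 2 < cdf D x) at_top"
    by (rule order_tendstoD(1)[OF D.cdf_lim_at_top_prob]) simp
  moreover have "eventually (\<lambda>x. - (x\<^sup>2 / 2) * cdf D x * ln (cdf D x) < 1) at_top"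
    by (rule order_tendstoD(2)[OF lim]) simp
  ultimately have "eventually (\<lambda>x. 0 < x \<and> 1 / 2 < cdf D x \<and>
      - (x\<^sup>2 / 2) * cdf D x * ln (cdf D x) < 1) at_top"
    using eventually_gt_at_top[of 0] by eventually_elim simp
  then obtain K where K: "\<And>x. K \<le> x \<Longrightarrow> 0 < x \<and> 1 / 2 < cdf D x \<and>
      - (x\<^sup>2 / 2) * cdf D x * ln (cdf D x) < 1"
    by (auto simp: eventually_at_top_linorder)
  have "1 - cdf D x \<le> 4 / x\<^sup>2" if "K \<le> x" for x
  proof -
    have x: "0 < x" "1 / 2 < cdf D x" "x\<^sup>2 / 2 * cdf D x * (- ln (cdf D x)) < 1"
      using K[OF that] by auto
    have "1 - cdf D x \<le> - ln (cdf D x)"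
      using ln_le_minus_one[of "cdf D x"] x by simp
    then have "x\<^sup>2 / 2 * (1 / 2) * (1 - cdf D x) \<le> x\<^sup>2 / 2 * cdf D x * (- ln (cdf D x))"
      using x D.cdf_bounded_prob[of x] by (intro mult_mono) auto
    with x show ?thesis by (simp add: field_simps)
  qed
  with K[of K] that show ?thesis by blast
qed

text \<open>
  The integrand is at most \<open>2 x\<close> up to \<open>K\<close> and at most \<open>2 x (4 / x\<^sup>2)\<^sup>2 = 32 / x ^ 3\<close> beyond.
\<close>

lemma tail_square_integral_finite:
  fixes g :: "real \<Rightarrow> real"
  assumes [measurable]: "g \<in> borel_measurable borel"
    and bounds: "\<And>x. 0 \<le> g x" "\<And>x. g x \<le> 1"
    and K: "0 < K" "\<And>x. K \<le> x \<Longrightarrow> g x \<le> 4 / x\<^sup>2"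
  shows "(\<integral>\<^sup>+x\<in>{0..}. ennreal (2 * x) * ennreal ((g x)\<^sup>2) \<partial>lborel) < \<infinity>"
proof -
  have near: "(\<integral>\<^sup>+x. ennreal (2 * x) * indicator {0..K} x \<partial>lborel) = ennreal (K\<^sup>2 - 0\<^sup>2)"
    using K by (intro nn_integral_FTC_Icc[where F = "\<lambda>x. x\<^sup>2"]) (auto intro!: derivative_eq_intros)
  have far: "(\<integral>\<^sup>+x. ennreal (32 / x ^ 3) * indicator {K..} x \<partial>lborel) = ennreal (0 - (- 16 / K\<^sup>2))"
  proof (rule nn_integral_FTC_atLeast[where F = "\<lambda>x. - 16 / x\<^sup>2"])
    show "((\<lambda>x::real. - 16 / x\<^sup>2) \<longlongrightarrow> 0) at_top" by real_asymp
    show "((\<lambda>x. - 16 / x\<^sup>2) has_real_derivative 32 / x ^ 3) (at x)" if "K \<le> x" for x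
      using that K by (auto intro!: derivative_eq_intros simp: field_simps power2_eq_square power3_eq_cube)
  qed (use K in auto)
  have "(\<integral>\<^sup>+x\<in>{0..}. ennreal (2 * x) * ennreal ((g x)\<^sup>2) \<partial>lborel) \<le>
      (\<integral>\<^sup>+x. ennreal (2 * x) * indicator {0..K} x + ennreal (32 / x ^ 3) * indicator {K..} x \<partial>lborel)"
  proof (rule nn_integral_mono)
    fix x :: real
    consider "x < 0" | "0 \<le> x" "x < K" | "K \<le> x" by linarith
    then show "ennreal (2 * x) * ennreal ((g x)\<^sup>2) * indicator {0..} x \<le>
        ennreal (2 * x) * indicator {0..K} x + ennreal (32 / x ^ 3) * indicator {K..} x"
    proof cases
      case 2
      have "2 * x * (g x)\<^sup>2 \<le> 2 * x * 1"
        using 2 bounds[of x] by (intro mult_left_mono power_le_one) auto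
      with 2 show ?thesis by (simp flip: ennreal_mult')
    next
      case 3
      have "2 * x * (g x)\<^sup>2 \<le> 2 * x * (4 / x\<^sup>2)\<^sup>2"
        using 3 K bounds[of x] by (intro mult_left_mono power_mono) auto
      also have "\<dots> = 32 / x ^ 3"
        using 3 K by (simp add: field_simps power2_eq_square power3_eq_cube)
      finally have "ennreal (2 * x) * ennreal ((g x)\<^sup>2) \<le> ennreal (32 / x ^ 3)"
        using 3 K by (simp flip: ennreal_mult' add: ennreal_leI)
      with 3 K show ?thesis by (simp add: add_increasing)
    qed simp
  qed
  also have "\<dots> = ennreal (K\<^sup>2 - 0\<^sup>2) + ennreal (0 - (- 16 / K\<^sup>2))"
    by (subst nn_integral_add) (simp_all only: near far, measurable)
  also have "\<dots> < \<infinity>" by simp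
  finally show ?thesis .
qed

section \<open>The series representation\<close>

theorem mainTheorem4:
  fixes M :: "'a measure" and X :: "'a \<Rightarrow> real"
  assumes "prob_space M"
    and "X \<in> borel_measurable M"
    and "AE \<omega> in M. 0 \<le> X \<omega>"
    and "absolutely_continuous lborel (distr M borel X)"
    and "((\<lambda>x. - (x\<^sup>2 / 2) * cdf (distr M borel X) x * ln (cdf (distr M borel X) x)) \<longlongrightarrow> 0) at_top"
  shows "(\<Sum>n. ennreal (1 / (real (Suc n) * real (Suc n + 1))) *
            order_statistic_moment2 M X 1 (Suc n + 1)) < \<infinity>
    \<and> enn2ereal (weighted_cumulative_entropy M X) =
        - ereal (1 / 2) * enn2ereal (\<Sum>n. ennreal (1 / (real (Suc n) * real (Suc n + 1))) *
            order_statistic_moment2 M X 1 (Suc n + 1))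
        + ereal (1 / 2) * enn2ereal (\<integral>\<^sup>+\<omega>. ennreal ((X \<omega>)\<^sup>2) \<partial>M)"
proof -
  interpret M: prob_space M by fact
  note [measurable] = assms(2)
  define D where "D = distr M borel X"
  define F where "F = cdf D"
  define g where "g x = 1 - F x" for x
  define c where "c n = 1 / (real (Suc n) * real (Suc n + 1))" for n
  define CE where "CE = weighted_cumulative_entropy M X"
  define S where "S = (\<Sum>n. ennreal (c n) * order_statistic_moment2 M X 1 (Suc n + 1))"
  define E where "E = (\<integral>\<^sup>+\<omega>. ennreal ((X \<omega>)\<^sup>2) \<partial>M)"
  interpret D: real_distribution D
    unfolding D_def by (rule M.real_distribution_distr) simp
  have g: "0 \<le> g x" "g x \<le> 1" for x
    using D.cdf_bounded_prob[of x] D.cdf_nonneg[of x] by (auto simp: g_def F_def)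
  have F_meas [measurable]: "F \<in> borel_measurable borel"
    unfolding F_def by (intro borel_measurable_mono monoI D.cdf_nondecreasing)
  have g_meas [measurable]: "g \<in> borel_measurable borel"
    unfolding g_def[abs_def] by measurable
  have tail: "measure D {x<..} = g x" for x
    using D.prob_compl[of "{..x}"] by (simp add: g_def F_def cdf_def Compl_eq_Diff_UNIV[symmetric])

  have c_nonneg: "0 \<le> c n" for n by (simp add: c_def)
  have "S = (\<Sum>n. \<integral>\<^sup>+x. ennreal (2 * x) * indicator {0..} x * ennreal (c n * g x ^ (Suc n + 1)) \<partial>lborel)"
    unfolding S_def
  proof (intro suminf_cong)
    fix n
    have "ennreal (c n) * order_statistic_moment2 M X 1 (Suc n + 1) =
        ennreal (c n) * (\<integral>\<^sup>+x\<in>{0..}. ennreal (2 * x) * ennreal (g x ^ (Suc n + 1)) \<partial>lborel)"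
      using order_statistic_moment2_1[OF assms(1-3), of "Suc n + 1"]
      by (simp only: tail D_def[symmetric] zero_less_Suc add_Suc simp_thms)
    also have "\<dots> = (\<integral>\<^sup>+x. ennreal (c n) * (ennreal (2 * x) * ennreal (g x ^ (Suc n + 1)) * indicator {0..} x) \<partial>lborel)"
      by (rule nn_integral_cmult[symmetric]) measurable
    also have "\<dots> = (\<integral>\<^sup>+x. ennreal (2 * x) * indicator {0..} x * ennreal (c n * g x ^ (Suc n + 1)) \<partial>lborel)"
      using g by (intro nn_integral_cong) (simp only: ennreal_mult c_nonneg zero_le_power mult_ac)
    finally show "ennreal (c n) * order_statistic_moment2 M X 1 (Suc n + 1) =
        (\<integral>\<^sup>+x. ennreal (2 * x) * indicator {0..} x * ennreal (c n * g x ^ (Suc n + 1)) \<partial>lborel)" .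
  qed
  also have "\<dots> = (\<integral>\<^sup>+x. (\<Sum>n. ennreal (2 * x) * indicator {0..} x * ennreal (c n * g x ^ (Suc n + 1))) \<partial>lborel)"
    by (rule nn_integral_suminf[symmetric]) measurable
  also have "\<dots> = (\<integral>\<^sup>+x\<in>{0..}. ennreal (2 * x) * ennreal (g x + (1 - g x) * ln (1 - g x)) \<partial>lborel)"
  proof (rule nn_integral_cong)
    fix x
    have "(\<lambda>n. c n * g x ^ (Suc n + 1)) sums (g x + (1 - g x) * ln (1 - g x))"
      unfolding c_def by (rule entropy_kernel_sums[OF g])
    then have "(\<Sum>n. ennreal (c n * g x ^ (Suc n + 1))) = ennreal (g x + (1 - g x) * ln (1 - g x))"
      using g by (intro suminf_ennreal_eq) (auto simp: c_def)
    then show "(\<Sum>n. ennreal (2 * x) * indicator {0..} x * ennreal (c n * g x ^ (Suc n + 1))) =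
        ennreal (2 * x) * ennreal (g x + (1 - g x) * ln (1 - g x)) * indicator {0..} x"
      by (simp add: mult_ac)
  qed
  finally have S: "S = (\<integral>\<^sup>+x\<in>{0..}. ennreal (2 * x) * ennreal (g x + (1 - g x) * ln (1 - g x)) \<partial>lborel)" .

  obtain K where K: "0 < K" "\<And>x. K \<le> x \<Longrightarrow> g x \<le> 4 / x\<^sup>2"
    using tail_quadratic_decay[OF D.real_distribution_axioms] assms(5)
    unfolding D_def[symmetric] F_def[symmetric] g_def by blast
  have "S \<le> (\<integral>\<^sup>+x\<in>{0..}. ennreal (2 * x) * ennreal ((g x)\<^sup>2) \<partial>lborel)"
    unfolding S by (intro nn_integral_mono mult_right_mono mult_left_mono ennreal_leI
      entropy_kernel_le_square g) auto
  also have "\<dots> < \<infinity>"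
    by (rule tail_square_integral_finite[OF g_meas g K])
  finally have S_finite: "S < \<infinity>" .

  \<comment> \<open>Both parts of the split are non-negative, so it survives integration even when \<open>E\<close> and
    \<open>CE\<close> are infinite; the subtraction is left to the end.\<close>
  have "E = (\<integral>\<^sup>+z. ennreal (z\<^sup>2) \<partial>D)"
    unfolding E_def D_def by (subst nn_integral_distr) auto
  also have "\<dots> = (\<integral>\<^sup>+x\<in>{0..}. ennreal (2 * x) * emeasure D {z \<in> space D. x < z} \<partial>lborel)"
  proof (intro nn_integral_square_eq_tail_integral D.sigma_finite_measure_axioms)
    show "AE z in D. 0 \<le> z"
      unfolding D_def using assms(3) by (subst AE_distr_iff) auto
  qed simp
  also have "\<dots> = (\<integral>\<^sup>+x\<in>{0..}. ennreal (2 * x) * ennreal (g x) \<partial>lborel)"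
    by (simp add: greaterThan_def[symmetric] D.emeasure_eq_measure tail)
  also have "\<dots> = (\<integral>\<^sup>+x. 2 * (ennreal (- (x * F x * ln (F x))) * indicator {0..} x) +
      ennreal (2 * x) * ennreal (g x + (1 - g x) * ln (1 - g x)) * indicator {0..} x \<partial>lborel)"
  proof (rule nn_integral_cong)
    fix x :: real
    show "ennreal (2 * x) * ennreal (g x) * indicator {0..} x =
      2 * (ennreal (- (x * F x * ln (F x))) * indicator {0..} x) +
      ennreal (2 * x) * ennreal (g x + (1 - g x) * ln (1 - g x)) * indicator {0..} x"
    proof (cases "0 \<le> x")
      case True
      have F: "F x = 1 - g x" by (simp add: g_def)
      have k: "0 \<le> g x + (1 - g x) * ln (1 - g x)"
        by (rule sums_le[OF _ sums_zero entropy_kernel_sums[OF g]]) (use g in auto)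
      have "ln (F x) \<le> 0"
        using g[of x] F by (cases "F x = 0") auto
      then have e: "0 \<le> - (x * F x * ln (F x))"
        using True g[of x] F by (simp add: mult_nonneg_nonpos)
      have merge: "2 * ennreal a + ennreal (2 * b) * ennreal d = ennreal (2 * a + 2 * b * d)"
        if "0 \<le> a" "0 \<le> b" "0 \<le> d" for a b d :: real
        using that by (simp add: ennreal_plus ennreal_mult del: ennreal_plus_if)
      have "2 * ennreal (- (x * F x * ln (F x))) + ennreal (2 * x) * ennreal (g x + (1 - g x) * ln (1 - g x))
          = ennreal (2 * (- (x * F x * ln (F x))) + 2 * x * (g x + (1 - g x) * ln (1 - g x)))"
        using merge[OF e True k] .
      also have "2 * (- (x * F x * ln (F x))) + 2 * x * (g x + (1 - g x) * ln (1 - g x)) = 2 * x * g x"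
        unfolding F by (simp add: algebra_simps)
      finally show ?thesis using True g by (simp add: ennreal_mult)
    qed simp
  qed
  also have "\<dots> = 2 * CE + S"
    unfolding S CE_def weighted_cumulative_entropy_def D_def[symmetric] F_def[symmetric]
    by (subst nn_integral_add, measurable, subst nn_integral_cmult, measurable)
  finally have E: "E = 2 * CE + S" .

  have "enn2ereal CE = - ereal (1 / 2) * enn2ereal S + ereal (1 / 2) * enn2ereal E"
  proof (cases CE)
    case (real r)
    from S_finite obtain s where s: "0 \<le> s" "S = ennreal s"
      by (cases S) auto
    have "E = ennreal (2 * r + s)"
      unfolding E using real s by (simp add: ennreal_mult ennreal_plus)
    then show ?thesis using real s by (simp add: enn2ereal_ennreal add_divide_distrib del: ennreal_plus_if ennreal_plus)
  next
    case top
    from S_finite obtain s where s: "0 \<le> s" "S = ennreal s"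
      by (cases S) auto
    have "E = \<infinity>" unfolding E top by (simp add: ennreal_mult_top)
    then show ?thesis using top s by (simp add: enn2ereal_ennreal)
  qed
  with S_finite show ?thesis
    unfolding S_def E_def CE_def c_def by blast
qed

end
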